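(* No randomized strategyproof mechanism for locating an obnoxious facility on $[0,1]$ can achieve an approximation ratio better than $$r=\left(\frac{4(3^p+1)}{3(3^p+1)+2}\right)^{1/p}$$ for the $L_p$ social utility, for any finite $p>0$. No randomized strategyproof mechanism can achieve an approximation ratio better than $\frac65$ for the $L_\infty$ social utility.
   Context: Agents $i=1,\dots,n$ have private locations $x_i\in[0,1]$. A randomized mechanism $f$ maps each reported profile $\mathbf x$ to a probability distribution $f(\mathbf x)$ over $[0,1]$. Agent $i$'s utility from a distribution $\pi$ is $\mathbb E_{y\sim\pi}|x_i-y|$. $f$ is strategyproof if no agent can increase its expected utility by misreporting its location, holding others' reports fixed. $L_p$ social utility: $\mathrm{su}_p(y,\mathbf x)=(\sum_i|x_i-y|^p)^{1/p}$ for finite $p>0$ and $\mathrm{su}_\infty(y,\mathbf x)=\max_i|x_i-y|$; the mechanism's value is $\mathbb E_{y\sim f(\mathbf x)}[\mathrm{su}_p(y,\mathbf x)]$. Approximation ratio: the supremum over all numbers of agents and all profiles $\mathbf x$ of $\max_{z\in[0,1]}\mathrm{su}_p(z,\mathbf x)/\mathbb E_{y\sim f(\mathbf x)}[\mathrm{su}_p(y,\mathbf x)]$. *)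

theory Defs
  imports "HOL-Probability.Probability"
begin

definition profile :: "real list \<Rightarrow> bool" where
  "profile xs \<longleftrightarrow> xs \<noteq> [] \<and> set xs \<subseteq> {0..1}"

definition mechanism :: "(real list \<Rightarrow> real measure) \<Rightarrow> bool" where
  "mechanism f \<longleftrightarrow> (\<forall>xs. profile xs \<longrightarrow>
      prob_space (f xs) \<and> sets (f xs) = sets borel \<and> (AE y in f xs. y \<in> {0..1}))"

definition util :: "real \<Rightarrow> real measure \<Rightarrow> real" where
  "util a M = (\<integral>y. \<bar>a - y\<bar> \<partial>M)"

definition strategyproof :: "(real list \<Rightarrow> real measure) \<Rightarrow> bool" where
  "strategyproof f \<longleftrightarrow> (\<forall>xs i x'. profile xs \<longrightarrow> i < length xs \<longrightarrow> x' \<in> {0..1} \<longrightarrow>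
      util (xs ! i) (f (xs[i := x'])) \<le> util (xs ! i) (f xs))"

definition su_p :: "real \<Rightarrow> real \<Rightarrow> real list \<Rightarrow> real" where
  "su_p p y xs = (\<Sum>i<length xs. \<bar>xs ! i - y\<bar> powr p) powr (1 / p)"

definition su_inf :: "real \<Rightarrow> real list \<Rightarrow> real" where
  "su_inf y xs = Max (set (map (\<lambda>x. \<bar>x - y\<bar>) xs))"

text \<open>Approximation ratio: supremum over all profiles of optimum / expected value
  (in the extended reals; a positive optimum over expected value 0 gives infinity).\<close>
definition approx_ratio ::
  "(real \<Rightarrow> real list \<Rightarrow> real) \<Rightarrow> (real list \<Rightarrow> real measure) \<Rightarrow> ereal" where
  "approx_ratio su f = (SUP xs \<in> {xs. profile xs}.
      ereal (SUP z \<in> {0..1}. su z xs) / ereal (\<integral>y. su y xs \<partial>(f xs)))"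

end

theory Submission imports Defs begin

text \<open>
  On [0,1] the distances to 1/3 and 2/3 sum to at most 1, so in a profile containing agents at both
  places one of them has expected utility at most 1/2. By strategyproofness this stays true, measured
  from its old place, after that agent moves to the nearer endpoint; but the only good facility
  location is then the opposite endpoint, at distance 2/3 from the old place. An affine bound of the
  social utility in terms of the distance to the old place yields the ratio.

  For \<open>p \<ge> 1\<close> and for the maximum, the profile (1/3, 2/3) suffices, by convexity of
  \<open>x powr p\<close> and concavity of \<open>x powr (1/p)\<close>. For \<open>p < 1\<close> the second
  function is convex and the two-agent profile is too weak. Doubling both agents and moving only one
  of them gives the ratio 15/13, which exceeds the claimed bound for all \<open>p\<close>.
\<close>

section \<open>Lower bounds on the ratio from a single misreport\<close>

lemma util_one_third_or_two_thirds_le: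
  assumes "prob_space M" and sets: "sets M = sets borel" and ae: "AE y in M. y \<in> {0..1}"
  shows "util (1/3) M \<le> 1/2 \<or> util (2/3) M \<le> 1/2"
proof -
  interpret prob_space M by fact
  have int: "integrable M (\<lambda>y. \<bar>a - y\<bar>)" for a
    by (rule integrable_const_bound[where B = "\<bar>a\<bar> + 1"])
      (use ae in \<open>auto simp: measurable_cong_sets[OF sets refl]\<close>)
  have "util (1/3) M + util (2/3) M = (\<integral>y. \<bar>1/3 - y\<bar> + \<bar>2/3 - y\<bar> \<partial>M)"
    unfolding util_def by (rule Bochner_Integration.integral_add[symmetric]) (rule int)+
  also have "\<dots> \<le> (\<integral>y. 1 \<partial>M)"
    by (rule integral_mono_AE) (use ae int in auto)
  also have "\<dots> = 1"
    by (simp add: prob_space)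
  finally show ?thesis by linarith
qed

text \<open>The affine majorant is centred at distance 1/2 so that \<open>m\<close> bounds the
  expectation: by strategyproofness the expected distance to the old place is still at most 1/2
  after the move, and \<open>k\<close> is nonnegative. Location \<open>z\<close> witnesses an
  optimum of at least \<open>R * m\<close>.\<close>

lemma approx_ratio_ge_by_deviation:
  assumes mech: "mechanism f" and sp: "strategyproof f"
    and xs: "profile xs" and i: "i < length xs" and x': "x' \<in> {0..1}"
    and util: "util (xs ! i) (f xs) \<le> 1/2"
    and nonneg: "\<And>y. y \<in> {0..1} \<Longrightarrow> 0 \<le> su y (xs[i := x'])"
    and bound: "\<And>y. y \<in> {0..1} \<Longrightarrow> su y (xs[i := x']) \<le> m + k * (\<bar>xs ! i - y\<bar> - 1/2)"
    and k: "0 \<le> k" and R: "0 < R"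
    and z: "z \<in> {0..1}" "0 < su z (xs[i := x'])" "R * m \<le> su z (xs[i := x'])"
  shows "ereal R \<le> approx_ratio su f"
proof -
  let ?a = "xs ! i" and ?ys = "xs[i := x']"
  let ?M = "f ?ys"
  have ys: "profile ?ys"
    using xs x' i set_update_subset_insert[of xs i x'] unfolding profile_def by auto
  interpret prob_space ?M using mech ys by (auto simp: mechanism_def)
  have sets: "sets ?M = sets borel" and ae: "AE y in ?M. y \<in> {0..1}"
    using mech ys by (auto simp: mechanism_def)
  have a: "?a \<in> {0..1}"
    using xs i nth_mem[OF i] unfolding profile_def by blast
  have int: "integrable ?M (\<lambda>y. \<bar>?a - y\<bar>)"
    by (rule integrable_const_bound[where B = "\<bar>?a\<bar> + 1"])
      (use ae in \<open>auto simp: measurable_cong_sets[OF sets refl]\<close>)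
  let ?E = "\<integral>y. su y ?ys \<partial>?M"
  have E0: "0 \<le> ?E"
    by (rule integral_nonneg_AE) (use ae nonneg in auto)
  have "?E \<le> (\<integral>y. m + k * (\<bar>?a - y\<bar> - 1/2) \<partial>?M)"
  proof (rule integral_mono_AE')
    show "integrable ?M (\<lambda>y. m + k * (\<bar>?a - y\<bar> - 1/2))" using int by simp
    show "AE y in ?M. su y ?ys \<le> m + k * (\<bar>?a - y\<bar> - 1/2)" using ae bound by auto
    \<comment> \<open>A non-integrable social utility has Bochner integral 0 by default;
      nonnegativity of the majorant covers that case.\<close>
    show "AE y in ?M. 0 \<le> m + k * (\<bar>?a - y\<bar> - 1/2)"
      using ae by eventually_elim (use bound nonneg order_trans in blast)
  qed
  also have "\<dots> = m + k * (util ?a ?M - 1/2)"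
    using int by (simp add: util_def prob_space)
  also have "\<dots> \<le> m"
  proof -
    have "util ?a ?M \<le> util ?a (f xs)"
      using sp xs i x' unfolding strategyproof_def by blast
    then have "k * (util ?a ?M - 1/2) \<le> 0"
      using util k by (simp add: mult_nonneg_nonpos)
    then show ?thesis by simp
  qed
  finally have Em: "?E \<le> m" .
  let ?S = "SUP z \<in> {0..1}. su z ?ys"
  have "bdd_above ((\<lambda>z. su z ?ys) ` {0..1})"
  proof (rule bdd_aboveI2)
    fix y :: real assume y: "y \<in> {0..1}"
    have "\<bar>?a - y\<bar> - 1/2 \<le> 1" using a y by auto
    then have "k * (\<bar>?a - y\<bar> - 1/2) \<le> k" using k mult_left_le by blast
    then show "su y ?ys \<le> m + k" using bound[OF y] by linarith
  qed
  then have S: "su z ?ys \<le> ?S" using z(1) by (rule cSUP_upper2) simp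
  have "ereal R \<le> ereal ?S / ereal ?E"
  proof (cases "?E = 0")
    \<comment> \<open>A positive optimum over expected value 0 counts as infinity, hence the
      assumption that \<open>su\<close> is positive at \<open>z\<close>.\<close>
    case True
    then show ?thesis using S z(2) by (simp add: divide_ereal_def)
  next
    case False
    with E0 have "0 < ?E" by simp
    moreover have "R * ?E \<le> ?S"
      using mult_left_mono[OF Em, of R] R z(3) S by linarith
    ultimately show ?thesis by (simp add: pos_le_divide_eq)
  qed
  also have "\<dots> \<le> approx_ratio su f"
    unfolding approx_ratio_def by (rule SUP_upper) (use ys in simp)
  finally show ?thesis .
qed

text \<open>The reflection of [0,1] exchanges the moves from 1/3 to 0 and from 2/3 to 1. With
  symmetric remaining agents, one affine bound serves both cases, and the good location 1 becomes
  0.\<close>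

lemma approx_ratio_ge_by_mirrored_deviations:
  assumes "mechanism f" "strategyproof f"
    and rest: "set rest \<subseteq> {0..1}"
    and mirror: "\<And>y. su y (1/3 # 1 # rest) = su (1 - y) (0 # 2/3 # rest)"
    and nonneg: "\<And>y. y \<in> {0..1} \<Longrightarrow> 0 \<le> su y (0 # 2/3 # rest)"
    and bound: "\<And>y. y \<in> {0..1} \<Longrightarrow> su y (0 # 2/3 # rest) \<le> m + k * (\<bar>1/3 - y\<bar> - 1/2)"
    and k: "0 \<le> k" and R: "0 < R"
    and opt: "0 < su 1 (0 # 2/3 # rest)" "R * m \<le> su 1 (0 # 2/3 # rest)"
  shows "ereal R \<le> approx_ratio su f"
proof -
  let ?xs = "1/3 # 2/3 # rest"
  have xs: "profile ?xs" using rest by (auto simp: profile_def)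
  then have "util (1/3) (f ?xs) \<le> 1/2 \<or> util (2/3) (f ?xs) \<le> 1/2"
    using assms(1) by (intro util_one_third_or_two_thirds_le) (auto simp: mechanism_def)
  then show ?thesis
  proof
    assume u: "util (1/3) (f ?xs) \<le> 1/2"
    show ?thesis
      by (rule approx_ratio_ge_by_deviation[OF assms(1,2) xs, of 0 0 su m k R 1])
        (use u nonneg bound k R opt in auto)
  next
    assume u: "util (2/3) (f ?xs) \<le> 1/2"
    have "su y (1/3 # 1 # rest) \<le> m + k * (\<bar>2/3 - y\<bar> - 1/2)" if "y \<in> {0..1}" for y
    proof -
      have "\<bar>1/3 - (1 - y)\<bar> = \<bar>2/3 - y\<bar>" by linarith
      then show ?thesis using bound[of "1 - y"] that mirror[of y] by simp
    qed
    then show ?thesis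
      by (intro approx_ratio_ge_by_deviation[OF assms(1,2) xs, of 1 1 su m k R 0])
        (use u nonneg mirror k R opt in auto)
  qed
qed

section \<open>Tangent and chord bounds for real powers\<close>

text \<open>Weighted AM-GM for \<open>t\<close> and 1 with weights \<open>p\<close> and
  \<open>1 - p\<close>.\<close>

lemma powr_le_tangent:
  fixes t p :: real
  assumes "0 \<le> t" "0 < p" "p \<le> 1"
  shows "t powr p \<le> 1 + p * (t - 1)"
  using Youngs_inequality_0[of p "1 - p" t 1] assms by (cases "t = 0") (auto simp: algebra_simps)

text \<open>Convexity on the interval from 1 to 3, the range of the distance (in units of 1/3) to
  the farther agent.\<close>

lemma powr_le_chord:
  fixes u p :: real
  assumes "0 \<le> u" "u \<le> 2" "1 \<le> p"
  shows "(1 + u) powr p \<le> 1 + (3 powr p - 1) * u / 2"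
proof -
  have "((1 - u/2) *\<^sub>R 1 + (u/2) *\<^sub>R 3) powr p \<le> (1 - u/2) * 1 powr p + (u/2) * 3 powr p"
    by (rule convex_onD[OF powr_convex]) (use assms in auto)
  moreover have "(1 - u/2) *\<^sub>R 1 + (u/2) *\<^sub>R 3 = 1 + u" by simp
  ultimately have "(1 + u) powr p \<le> (1 - u/2) * 1 powr p + (u/2) * 3 powr p" by (simp only:)
  then show ?thesis by (simp add: field_simps)
qed

lemma abs_diff_powr_scale_third:
  fixes a y p :: real
  shows "\<bar>a / 3 - y\<bar> powr p = (1/3) powr p * \<bar>a - 3 * y\<bar> powr p"
proof -
  have "\<bar>a / 3 - y\<bar> = 1/3 * \<bar>a - 3 * y\<bar>" by (auto simp: abs_if field_simps)
  then show ?thesis by (simp only: powr_mult)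
qed

section \<open>The maximum distance\<close>

text \<open>The larger of the distances to 0 and 2/3 equals 1/3 plus the distance to their midpoint
  1/3. Hence the expectation is at most 5/6, against the value 1 at location 1.\<close>

lemma approx_ratio_su_inf:
  assumes "mechanism f" "strategyproof f"
  shows "ereal (6/5) \<le> approx_ratio su_inf f"
  by (rule approx_ratio_ge_by_mirrored_deviations[OF assms, of "[]" _ "5/6" 1])
    (auto simp: su_inf_def max_def abs_if)

section \<open>Finite exponents at least 1, with two agents\<close>

lemma approx_ratio_su_p_ge_1:
  assumes "mechanism f" "strategyproof f" and p: "1 \<le> p"
  shows "ereal ((4 * (3 powr p + 1) / (3 * (3 powr p + 1) + 2)) powr (1 / p))
         \<le> approx_ratio (su_p p) f"
proof -
  \<comment> \<open>In units of 1/3, \<open>A\<close> is the power sum at location 1, and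
    \<open>B\<close> is the value of the chord bound \<open>2 + (A - 2) * u / 2\<close> at
    \<open>u = 3/2\<close>, that is, at distance 1/2. The ratio is
    \<open>(A / B) powr (1 / p)\<close>.\<close>
  define A B where "A = 3 powr p + (1::real)" and "B = (3 * A + 2) / 4"
  let ?q = "1 / p"
  have A: "A > 2" using p powr_less_mono[of 0 p "3::real"] by (simp add: A_def)
  then have B: "B > 0" by (simp add: B_def)
  have q: "0 < ?q" "?q \<le> 1" using p by auto
  have third: "((1/3) powr p) powr ?q = 1/3" using p by (simp add: powr_powr)
  have scale: "su_p p y [0, 2/3] = 1/3 * ((\<bar>3 * y\<bar> powr p + \<bar>2 - 3 * y\<bar> powr p) powr ?q)" for y
  proof -
    have "su_p p y [0, 2/3]
        = ((1/3) powr p * (\<bar>3 * y\<bar> powr p + \<bar>2 - 3 * y\<bar> powr p)) powr ?q"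
      using abs_diff_powr_scale_third[of 0 y p] abs_diff_powr_scale_third[of 2 y p]
      by (simp add: su_p_def lessThan_Suc numeral_2_eq_2 algebra_simps)
    then show ?thesis by (simp add: powr_mult third del: powr_powr)
  qed
  have bound: "su_p p y [0, 2/3]
      \<le> B powr ?q / 3 + (B powr ?q * ?q * ((A - 2) / (2 * B))) * (\<bar>1/3 - y\<bar> - 1/2)"
    if y: "y \<in> {0..1}" for y
  proof -
    define u where "u = \<bar>1 - 3 * y\<bar>"
    have u: "0 \<le> u" "u \<le> 2" "\<bar>1/3 - y\<bar> = u / 3" using y by (auto simp: u_def abs_if field_simps)
    let ?T = "\<bar>3 * y\<bar> powr p + \<bar>2 - 3 * y\<bar> powr p"
    \<comment> \<open>The old place is the midpoint of the two agents: the farther one is at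
      distance \<open>1 + u\<close>, the nearer one at most 1.\<close>
    have "?T \<le> (1 + u) powr p + 1"
    proof (cases "3 * y \<le> 1")
      case True
      then have "\<bar>2 - 3 * y\<bar> = 1 + u" by (simp add: u_def)
      moreover have "\<bar>3 * y\<bar> powr p \<le> 1" using True y p by (intro powr_le1) auto
      ultimately show ?thesis by simp
    next
      case False
      then have "\<bar>3 * y\<bar> = 1 + u" by (simp add: u_def)
      moreover have "\<bar>2 - 3 * y\<bar> powr p \<le> 1" using False y p by (intro powr_le1) auto
      ultimately show ?thesis by simp
    qed
    also have "\<dots> \<le> 2 + (A - 2) * u / 2"
      using powr_le_chord[OF u(1,2) p] by (simp add: A_def)
    finally have T: "?T / B \<le> (2 + (A - 2) * u / 2) / B" using B by (simp add: divide_right_mono)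
    \<comment> \<open>Factoring out \<open>B\<close> turns the tangent at 1 into the tangent of the
      concave outer power at \<open>B\<close>.\<close>
    have "?T powr ?q = B powr ?q * (?T / B) powr ?q"
      using B by (simp add: powr_divide)
    also have "\<dots> \<le> B powr ?q * (1 + ?q * (?T / B - 1))"
      using B q by (intro mult_left_mono powr_le_tangent) auto
    also have "\<dots> \<le> B powr ?q * (1 + ?q * ((2 + (A - 2) * u / 2) / B - 1))"
      using q T by (intro mult_left_mono add_left_mono diff_right_mono) auto
    also have "(2 + (A - 2) * u / 2) / B - 1 = (A - 2) / (2 * B) * (u - 3/2)"
    proof -
      have "2 + (A - 2) * u / 2 - B = (A - 2) / 2 * (u - 3/2)" by (simp add: B_def field_simps)
      then have "(2 + (A - 2) * u / 2 - B) / B = (A - 2) / 2 * (u - 3/2) / B" by (simp only:)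
      then have "(2 + (A - 2) * u / 2) / B - B / B = (A - 2) / (2 * B) * (u - 3/2)"
        unfolding diff_divide_distrib[of "2 + (A - 2) * u / 2"] by simp
      then show ?thesis using B by simp
    qed
    finally have "?T powr ?q \<le> B powr ?q * (1 + ?q * ((A - 2) / (2 * B) * (u - 3/2)))" .
    moreover have "1/3 * (w * (1 + ?q * (c * (u - 3/2)))) = w / 3 + w * ?q * c * (u / 3 - 1/2)"
      for w c :: real by (simp add: algebra_simps)
    ultimately show ?thesis unfolding scale u(3) by (metis mult_left_mono zero_le_divide_1_iff zero_le_numeral)
  qed
  have opt: "su_p p 1 [0, 2/3] = A powr ?q / 3" by (simp add: scale A_def)
  have R: "(4 * A / (3 * A + 2)) powr ?q * (B powr ?q / 3) = A powr ?q / 3"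
  proof -
    have "4 * A / (3 * A + 2) * B = A" using A by (simp add: B_def)
    then show ?thesis using A B by (simp add: powr_mult[symmetric])
  qed
  show ?thesis unfolding A_def[symmetric]
  proof (rule approx_ratio_ge_by_mirrored_deviations[OF assms(1,2), of "[]"])
    fix y :: real
    have "\<bar>1/3 - y\<bar> = \<bar>2/3 - (1 - y)\<bar>" "\<bar>1 - y\<bar> = \<bar>0 - (1 - y)\<bar>" by linarith+
    then show "su_p p y [1/3, 1] = su_p p (1 - y) [0, 2/3]"
      by (simp add: su_p_def lessThan_Suc numeral_2_eq_2 add.commute)
  next
    fix y :: real assume "y \<in> {0..1}"
    then show "su_p p y [0, 2/3]
      \<le> B powr ?q / 3 + (B powr ?q * ?q * ((A - 2) / (2 * B))) * (\<bar>1/3 - y\<bar> - 1/2)" by (rule bound)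
  qed (use A B q R opt in \<open>auto simp: su_p_def[of _ _ "[0, 2/3]"]\<close>)
qed

section \<open>Exponents at most 1, with four agents\<close>

text \<open>The hypothesis is the tangent inequality of the (concave) power mean at (3,2,1,1), the vector
  of distances, in units of 1/3, from the optimal location 1 to the agents at 0, 1/3, 2/3, 2/3.\<close>
lemma sum_four_powr_le:
  fixes p l :: real
  assumes p: "0 < p" "p \<le> 1" and l: "0 < l"
    and d: "0 \<le> d1" "0 \<le> d2" "0 \<le> d3" "0 \<le> d4"
    and le: "3 powr (p - 1) * d1 + 2 powr (p - 1) * d2 + d3 + d4
          \<le> l * (3 * 3 powr (p - 1) + 2 * 2 powr (p - 1) + 2)"
  shows "d1 powr p + d2 powr p + d3 powr p + d4 powr p \<le> l powr p * (3 powr p + 2 powr p + 2)"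
proof -
  \<comment> \<open>This is the tangent of \<open>x powr p\<close> at \<open>l * e\<close>. Its
    factor \<open>p * l powr (p - 1)\<close> is common to e = 3, 2, 1, 1, so the four correction
    terms add up to a multiple of the assumed inequality.\<close>
  have tangent: "d powr p \<le> l powr p * e powr p
      + p * l powr (p - 1) * (e powr (p - 1) * d - l * (e * e powr (p - 1)))"
    if "0 < e" "0 \<le> d" for d e :: real
  proof -
    have "d powr p = (l * e) powr p * (d / (l * e)) powr p"
      using that l by (simp add: powr_divide)
    also have "\<dots> \<le> (l * e) powr p * (1 + p * (d / (l * e) - 1))"
      using that l p by (intro mult_left_mono powr_le_tangent) auto
    also have "\<dots> = l powr p * e powr p
      + p * l powr (p - 1) * (e powr (p - 1) * d - l * (e * e powr (p - 1)))"
      using that l by (simp add: powr_mult powr_diff field_simps)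
    finally show ?thesis .
  qed
  let ?c = "p * l powr (p - 1)"
  have "?c * (3 powr (p - 1) * d1 + 2 powr (p - 1) * d2 + d3 + d4
          - l * (3 * 3 powr (p - 1) + 2 * 2 powr (p - 1) + 2)) \<le> 0"
    using le p by (intro mult_nonneg_nonpos) auto
  then show ?thesis
    using tangent[of 3 d1] tangent[of 2 d2] tangent[of 1 d3] tangent[of 1 d4] d
    by (simp add: algebra_simps)
qed

text \<open>In logarithms the claim reads \<open>ln 4 \<le> g p\<close>; equality holds at 0, and
  \<open>g\<close> is nondecreasing.\<close>

lemma ratio_le_fifteen_thirteenths:
  fixes p :: real
  assumes p: "0 < p"
  shows "(4 * (3 powr p + 1) / (3 * (3 powr p + 1) + 2)) powr (1 / p) \<le> 15 / 13"
proof -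
  define g where "g x = x * ln (15/13) - ln (3 powr x + 1) + ln (3 * 3 powr x + 5)" for x :: real
  \<comment> \<open>The rational 4/31 lies just above the maximum \<open>1 / (4 + sqrt 15)\<close>
    of the coefficient of \<open>ln 3\<close> in the derivative of \<open>g\<close>.\<close>
  have "ln ((3::real) ^ 4) \<le> ln ((15/13) ^ 31)" by (subst ln_le_cancel_iff) (simp_all add: field_simps)
  then have ln3: "4 / 31 * ln 3 \<le> ln (15/13::real)" by (simp add: ln_realpow del: power_numeral)
  have "g 0 \<le> g p"
  proof (rule DERIV_nonneg_imp_nondecreasing[where f = g])
    fix x :: real
    let ?t = "3 powr x :: real"
    let ?D = "ln (15/13) - ?t * ln 3 / (?t + 1) + 3 * ?t * ln 3 / (3 * ?t + 5)"
    have t: "?t > 0" by simp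
    then have pos: "0 < ?t + 1" "0 < 3 * ?t + 5" by (auto intro: add_pos_pos)
    have "?t / (?t + 1) - 3 * ?t / (3 * ?t + 5) \<le> 4 / 31"
    proof -
      \<comment> \<open>Completed square of \<open>12 * ?t^2 - 30 * ?t + 20\<close>, the difference
        after clearing denominators.\<close>
      have "0 \<le> 12 * (?t - 5/4)\<^sup>2 + 5/4" by simp
      then have "2 * ?t \<le> 4 / 31 * ((?t + 1) * (3 * ?t + 5))" by (simp add: power2_eq_square algebra_simps)
      moreover have "?t / (?t + 1) - 3 * ?t / (3 * ?t + 5) = 2 * ?t / ((?t + 1) * (3 * ?t + 5))"
        using pos by (simp add: divide_simps) (simp add: algebra_simps)
      ultimately show ?thesis using pos by (simp add: pos_divide_le_eq)
    qed
    then have "(?t / (?t + 1) - 3 * ?t / (3 * ?t + 5)) * ln 3 \<le> 4 / 31 * ln 3"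
      by (intro mult_right_mono) auto
    moreover have "?D = ln (15/13) - (?t / (?t + 1) - 3 * ?t / (3 * ?t + 5)) * ln 3"
      by (simp add: left_diff_distrib)
    ultimately have D: "?D \<ge> 0" using ln3 by linarith
    have "(g has_real_derivative ?D) (at x)"
      unfolding g_def using pos
      by (auto intro!: derivative_eq_intros simp: field_simps)
    with D show "\<exists>d. (g has_real_derivative d) (at x) \<and> 0 \<le> d" by blast
  qed (use p in simp)
  moreover have "g 0 = ln 4" using ln_div[of 8 "2::real"] by (simp add: g_def)
  ultimately have g: "ln 4 \<le> g p" by simp
  let ?r = "4 * (3 powr p + 1) / (3 * (3 powr p + 1) + 2) :: real"
  have pos: "0 < 3 powr p + (1::real)" "0 < 3 * 3 powr p + (5::real)" by (auto intro: add_pos_pos)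
  have r: "0 < ?r" using pos by (simp add: algebra_simps)
  have "ln ?r = ln 4 + ln (3 powr p + 1) - ln (3 * 3 powr p + 5)"
  proof -
    have "?r = 4 * (3 powr p + 1) / (3 * 3 powr p + 5)" by simp
    then show ?thesis using pos by (simp only: ln_div ln_mult) simp
  qed
  then have "1 / p * ln ?r \<le> ln (15/13)" using g p by (simp add: g_def field_simps)
  then have "ln (?r powr (1 / p)) \<le> ln (15/13)" using r by (simp add: ln_powr)
  then show ?thesis using r by (subst (asm) ln_le_cancel_iff) auto
qed

text \<open>The power sum is bounded by \<open>l powr p * A\<close> with \<open>l\<close> affine in
  the distance to the old place, so the outer power 1/p returns an affine bound although it is
  convex. At distance 1/2, \<open>l\<close> is 13/15, and at the optimum it is 1.\<close>

lemma approx_ratio_su_p_le_1: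
  assumes "mechanism f" "strategyproof f" and p: "0 < p" "p \<le> 1"
  shows "ereal (15/13) \<le> approx_ratio (su_p p) f"
proof -
  let ?q = "1 / p"
  define \<alpha> \<beta> where "\<alpha> = 3 powr (p - 1)" and "\<beta> = (2::real) powr (p - 1)"
  have \<alpha>: "1/3 \<le> \<alpha>" using powr_mono[of "-1" "p - 1" "3::real"] p by (simp add: \<alpha>_def powr_minus)
  have \<beta>: "0 \<le> \<beta>" "\<beta> \<le> 1" using powr_mono[of "p - 1" 0 "2::real"] p by (simp_all add: \<beta>_def)
  define A where "A = 3 powr p + 2 powr p + (2::real)"
  define T where "T y = \<bar>3 * y\<bar> powr p + \<bar>2 - 3 * y\<bar> powr p + \<bar>1 - 3 * y\<bar> powr p
      + \<bar>2 - 3 * y\<bar> powr p" for y :: real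
  have A: "0 < A" unfolding A_def by (intro add_pos_pos) simp_all
  have third: "((1/3) powr p) powr ?q = 1/3" using p by (simp add: powr_powr)
  have scale: "su_p p y [0, 2/3, 1/3, 2/3] = 1/3 * (T y powr ?q)" for y
  proof -
    have "su_p p y [0, 2/3, 1/3, 2/3] = ((1/3) powr p * T y) powr ?q"
      using abs_diff_powr_scale_third[of 0 y p] abs_diff_powr_scale_third[of 1 y p]
        abs_diff_powr_scale_third[of 2 y p]
      by (simp add: su_p_def T_def lessThan_Suc numeral_eq_Suc algebra_simps)
    then show ?thesis by (simp add: powr_mult third del: powr_powr)
  qed
  have bound: "su_p p y [0, 2/3, 1/3, 2/3]
      \<le> 13/45 * A powr ?q + 4/15 * A powr ?q * (\<bar>1/3 - y\<bar> - 1/2)"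
    if y: "y \<in> {0..1}" for y
  proof -
    define u where "u = \<bar>1 - 3 * y\<bar>"
    \<comment> \<open>Normalised to 1 at \<open>u = 2\<close>, the optimum. The value 7/15 at
      \<open>u = 0\<close> is the least for which the tangent condition at \<open>y = 1/3\<close>
      follows from \<alpha> \<ge> 1/3 and \<beta> \<le> 1.\<close>
    define l where "l = 7/15 + 4/15 * u"
    have u: "0 \<le> u" "\<bar>1/3 - y\<bar> = u / 3" by (auto simp: u_def abs_if field_simps)
    then have l: "0 < l" by (simp add: l_def)
    have "T y \<le> l powr p * A"
    proof -
      \<comment> \<open>The pairing of agents with the weights \<open>\<alpha>, \<beta>, 1, 1\<close> is free; giving the small
        weights to the distant agents makes the tangent bound sharp enough on each piece.\<close>
      note four = sum_four_powr_le[OF p l, folded \<alpha>_def \<beta>_def A_def]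
      consider "3 * y \<le> 1" | "1 \<le> 3 * y" "3 * y \<le> 2" | "2 \<le> 3 * y" by linarith
      then show ?thesis
      proof cases
        case 1
        then have uy: "u = 1 - 3 * y" by (simp add: u_def)
        \<comment> \<open>Both sides are affine in \<open>y\<close> on each piece; the products
          interpolate 15 times the slack between its endpoint values. At \<open>y = 1\<close> the
          slack vanishes, so the last piece has a single product.\<close>
        have "\<alpha> * (2 - 3 * y) + \<beta> * (2 - 3 * y) + 3 * y + (1 - 3 * y) \<le> l * (3 * \<alpha> + 2 * \<beta> + 2)"
          using mult_nonneg_nonneg[of "1 - 3 * y" "3 * \<alpha> - 8 * \<beta> + 7"]
            mult_nonneg_nonneg[of "3 * y" "6 * \<alpha> - \<beta> - 1"] \<alpha> \<beta> y 1
          unfolding l_def uy by (simp add: field_simps)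
        from four[OF _ _ _ _ this] show ?thesis using 1 y by (simp add: T_def)
      next
        case 2
        then have uy: "u = 3 * y - 1" by (simp add: u_def)
        have "\<alpha> * (3 * y) + \<beta> * (2 - 3 * y) + (3 * y - 1) + (2 - 3 * y) \<le> l * (3 * \<alpha> + 2 * \<beta> + 2)"
          using mult_nonneg_nonneg[of "2 - 3 * y" "6 * \<alpha> - \<beta> - 1"]
            mult_nonneg_nonneg[of "3 * y - 1" "3 * \<alpha> + 22 * \<beta> + 7"] \<alpha> \<beta> y 2
          unfolding l_def uy by (simp add: field_simps)
        from four[OF _ _ _ _ this] show ?thesis using 2 y by (simp add: T_def)
      next
        case 3
        then have uy: "u = 3 * y - 1" by (simp add: u_def)
        have "\<alpha> * (3 * y) + \<beta> * (3 * y - 1) + (3 * y - 2) + (3 * y - 2) \<le> l * (3 * \<alpha> + 2 * \<beta> + 2)"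
          using mult_nonneg_nonneg[of "3 - 3 * y" "3 * \<alpha> + 7 * \<beta> + 22"] \<alpha> \<beta> y 3
          unfolding l_def uy by (simp add: field_simps)
        from four[OF _ _ _ _ this] show ?thesis using 3 y by (simp add: T_def)
      qed
    qed
    then have "T y powr ?q \<le> (l powr p * A) powr ?q"
      using p by (intro powr_mono2) (auto simp: T_def)
    also have "\<dots> = l * A powr ?q"
      using l A p by (simp add: powr_mult powr_powr)
    finally show ?thesis unfolding scale u(2) by (simp add: l_def field_simps)
  qed
  have opt: "su_p p 1 [0, 2/3, 1/3, 2/3] = A powr ?q / 3" by (simp add: scale T_def A_def add_ac)
  show ?thesis
  proof (rule approx_ratio_ge_by_mirrored_deviations[OF assms(1,2), of "[1/3, 2/3]"])
    fix y :: real
    have "\<bar>1/3 - y\<bar> = \<bar>2/3 - (1 - y)\<bar>" "\<bar>1 - y\<bar> = \<bar>0 - (1 - y)\<bar>" "\<bar>2/3 - y\<bar> = \<bar>1/3 - (1 - y)\<bar>"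
      by linarith+
    then show "su_p p y [1/3, 1, 1/3, 2/3] = su_p p (1 - y) [0, 2/3, 1/3, 2/3]"
      by (simp add: su_p_def lessThan_Suc numeral_eq_Suc algebra_simps)
  next
    fix y :: real assume "y \<in> {0..1}"
    then show "su_p p y [0, 2/3, 1/3, 2/3]
      \<le> 13/45 * A powr ?q + 4/15 * A powr ?q * (\<bar>1/3 - y\<bar> - 1/2)" by (rule bound)
  qed (use A opt in \<open>auto simp: su_p_def[of _ _ "[0, 2/3, 1/3, 2/3]"]\<close>)
qed

theorem theorem4:
  fixes f :: "real list \<Rightarrow> real measure"
  assumes "mechanism f" and "strategyproof f"
  shows "(\<forall>p::real. p > 0 \<longrightarrow>
            approx_ratio (su_p p) f \<ge>
              ereal ((4 * (3 powr p + 1) / (3 * (3 powr p + 1) + 2)) powr (1 / p)))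
         \<and> approx_ratio su_inf f \<ge> ereal (6 / 5)"
proof (intro conjI allI impI)
  fix p :: real assume p: "p > 0"
  let ?r = "(4 * (3 powr p + 1) / (3 * (3 powr p + 1) + 2)) powr (1 / p)"
  show "ereal ?r \<le> approx_ratio (su_p p) f"
  proof (cases "p \<ge> 1")
    case True
    then show ?thesis by (rule approx_ratio_su_p_ge_1[OF assms])
  next
    case False
    have "ereal ?r \<le> ereal (15/13)" using ratio_le_fifteen_thirteenths[OF p] by simp
    also have "\<dots> \<le> approx_ratio (su_p p) f"
      using False p by (intro approx_ratio_su_p_le_1[OF assms]) auto
    finally show ?thesis .
  qed
qed (rule approx_ratio_su_inf[OF assms])

end
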